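(* Let $\Lambda$ be a set, $\mathbb{F}$ a field, and let $K,Q:\Lambda^2\to\mathbb{F}$ be two functions. Suppose that $K$ and $Q$ are both of class $\mathcal{D}$. If $K$ and $Q$ are determinantally equivalent, then $Q$ can be transformed into $K$ through only conjugation transformations and transposition transformations; that is, there is a finite sequence of functions $\Lambda^2\to\mathbb{F}$ starting at $Q$ and ending at $K$ in which each function is obtained from the previous one by a conjugation transformation or by a transposition transformation.
   Context: $\Lambda$ is a set of arbitrary cardinality and $\mathbb{F}$ is an arbitrary field. Determinantally equivalent: $K,Q:\Lambda^2\to\mathbb{F}$ are determinantally equivalent if $\det(Q(x_i,x_j))_{i,j=1}^n=\det(K(x_i,x_j))_{i,j=1}^n$ for all $n\in\mathbb{N}$ and all $x_1,\ldots,x_n\in\Lambda$. Class $\mathcal{D}$: $h:\Lambda^2\to\mathbb{F}$ is of class $\mathcal{D}$ if for all pairwise distinct $x,y,z,w\in\Lambda$, $h(x,y)h(w,z)-h(x,z)h(w,y)\neq 0$. Conjugation transformation: $F:\Lambda^2\to\mathbb{F}$ is obtained from $G:\Lambda^2\to\mathbb{F}$ by a conjugation transformation if there is a nowhere zero function $g:\Lambda\to\mathbb{F}$ with $F(x,y)=g(x)G(x,y)g(y)^{-1}$ for all $x,y\in\Lambda$. Transposition transformation: $F$ is obtained from $G$ by a transposition transformation if $F(x,y)=G(y,x)$ for all $x,y\in\Lambda$.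
   Formalization: The formal theorem assumes that Λ does not have exactly 2 or 3 elements; for those sizes class D is vacuous and the claim fails (Q = 0, K nonzero at a single off-diagonal position). *)

theory Defs
  imports "Jordan_Normal_Form.Determinant"
begin

text \<open>
  A function on the square of a set \<open>L\<close> is a curried function on the ambient type, of which only
  the values at points of \<open>L\<close> matter; every notion below looks at \<open>L\<close> only.
\<close>

definition determinantally_equivalent ::
    "'a set \<Rightarrow> ('a \<Rightarrow> 'a \<Rightarrow> 'f::field) \<Rightarrow> ('a \<Rightarrow> 'a \<Rightarrow> 'f) \<Rightarrow> bool" where
  "determinantally_equivalent L K Q \<longleftrightarrow>
    (\<forall>(n::nat) x. (\<forall>i<n. x i \<in> L) \<longrightarrow>
      det (mat n n (\<lambda>(i, j). Q (x i) (x j))) = det (mat n n (\<lambda>(i, j). K (x i) (x j))))"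

text \<open>Vacuously true if \<open>L\<close> has fewer than four points.\<close>

definition class_D :: "'a set \<Rightarrow> ('a \<Rightarrow> 'a \<Rightarrow> 'f::field) \<Rightarrow> bool" where
  "class_D L h \<longleftrightarrow>
    (\<forall>x\<in>L. \<forall>y\<in>L. \<forall>z\<in>L. \<forall>w\<in>L. distinct [x, y, z, w] \<longrightarrow>
      h x y * h w z - h x z * h w y \<noteq> 0)"

text \<open>In the following three relations the second function is obtained from the first.\<close>

definition conjugation_transformation ::
    "'a set \<Rightarrow> ('a \<Rightarrow> 'a \<Rightarrow> 'f::field) \<Rightarrow> ('a \<Rightarrow> 'a \<Rightarrow> 'f) \<Rightarrow> bool" where
  "conjugation_transformation L G F \<longleftrightarrow>
    (\<exists>g. (\<forall>x\<in>L. g x \<noteq> 0) \<and> (\<forall>x\<in>L. \<forall>y\<in>L. F x y = g x * G x y * inverse (g y)))"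

definition transposition_transformation ::
    "'a set \<Rightarrow> ('a \<Rightarrow> 'a \<Rightarrow> 'f::field) \<Rightarrow> ('a \<Rightarrow> 'a \<Rightarrow> 'f) \<Rightarrow> bool" where
  "transposition_transformation L G F \<longleftrightarrow> (\<forall>x\<in>L. \<forall>y\<in>L. F x y = G y x)"

definition transformation_step ::
    "'a set \<Rightarrow> ('a \<Rightarrow> 'a \<Rightarrow> 'f::field) \<Rightarrow> ('a \<Rightarrow> 'a \<Rightarrow> 'f) \<Rightarrow> bool" where
  "transformation_step L G F \<longleftrightarrow>
    conjugation_transformation L G F \<or> transposition_transformation L G F"

text \<open>
  For finite sequences of steps we take the reflexive transitive closure. Two functions that agree
  on \<open>L\<close> but differ elsewhere are still related: conjugate by the constant function 1.
\<close>

abbreviation transformable ::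
    "'a set \<Rightarrow> ('a \<Rightarrow> 'a \<Rightarrow> 'f::field) \<Rightarrow> ('a \<Rightarrow> 'a \<Rightarrow> 'f) \<Rightarrow> bool" where
  "transformable L \<equiv> (transformation_step L)\<^sup>*\<^sup>*"

end

theory Submission
  imports Defs
begin

text \<open>
  If all off-diagonal entries are nonzero, the argument runs over cycles. The principal minors
  of size at most three determine, for every triangle, the unordered pair of its two oriented cycle
  products, so on each triangle the second function either preserves or reverses the orientations of
  the first (\<open>triple\<close>). If all triangles at one point are preserved, the two functions are conjugate;
  if all are reversed, one is conjugate to the transpose of the other
  (\<open>conjugation_if_preserved\<close>). The principal minors of size four and class D exclude that of two
  triangles with a common edge one is genuinely reversed and the other genuinely preserved
  (\<open>four_points\<close>), and a cocycle relation between the cycle products of the faces of a tetrahedron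
  spreads this to any two triangles at a point (\<open>preserved_or_reversed_at_base\<close>).

  On four or more points class D allows zeros, although at most one in each row and in each column
  off the diagonal. They are removed by pivoting, that is by replacing \<open>A x y\<close> by \<open>A x y - X (A x v) (A v y)\<close> with an
  indeterminate \<open>X\<close>. A principal minor of the new function is a combination of a principal minor of
  \<open>A\<close> and the one with \<open>v\<close> added, so determinantal equivalence persists (\<open>det_pivot\<close>); so does class D
  (\<open>class_D_pivot\<close>). Two pivots, at points joined by nonzero entries in both directions, leave no
  off-diagonal zero. A conjugation between the pivots is also one between the original functions, a
  priori with rational functions as factors, and as the nonzero entries connect all points, the factors
  can be chosen in the ground field (\<open>conjugation_transformation_from_pivot\<close>).
\<close>

section \<open>Principal minors and cycle sums\<close>

lemma det_laplace_first_row: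
  fixes f :: "nat \<times> nat \<Rightarrow> 'r::comm_ring_1"
  shows "det (mat (Suc n) (Suc n) f) =
    (\<Sum>j<Suc n. (-1) ^ j * f (0, j) *
      det (mat n n (\<lambda>(i, k). f (Suc i, if k < j then k else Suc k))))"
proof -
  have "det (mat (Suc n) (Suc n) f) =
      (\<Sum>j<Suc n. mat (Suc n) (Suc n) f $$ (0, j) * cofactor (mat (Suc n) (Suc n) f) 0 j)"
    by (rule laplace_expansion_row) auto
  also have "\<dots> = (\<Sum>j<Suc n. (-1) ^ j * f (0, j) *
      det (mat n n (\<lambda>(i, k). f (Suc i, if k < j then k else Suc k))))"
  proof (rule sum.cong)
    fix j assume "j \<in> {..<Suc n}"
    moreover have "mat_delete (mat (Suc n) (Suc n) f) 0 j =
        mat n n (\<lambda>(i, k). f (Suc i, if k < j then k else Suc k))"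
      using \<open>j \<in> {..<Suc n}\<close> by (intro eq_matI) (auto simp: mat_delete_def)
    ultimately show "mat (Suc n) (Suc n) f $$ (0, j) * cofactor (mat (Suc n) (Suc n) f) 0 j =
        (-1) ^ j * f (0, j) * det (mat n n (\<lambda>(i, k). f (Suc i, if k < j then k else Suc k)))"
      by (simp add: cofactor_def)
  qed simp
  finally show ?thesis .
qed

text \<open>
  This is the matrix determinant lemma without inverses. Border \<open>m\<close> by the column \<open>c\<close>, the row
  \<open>s r\<close> and the corner \<open>1\<close>. Clearing the row by column operations leaves the updated matrix as the
  remaining block, so the bordered determinant is the left-hand side. The corner and the row of a
  bordered determinant enter linearly, and this trades the corner \<open>1\<close> and the row \<open>s r\<close> for \<open>a\<close> and
  \<open>r\<close>, at the price of a multiple of \<open>det m\<close>. The corner \<open>a\<close> is free, so that it can be chosen to make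
  the bordered matrix a principal submatrix.
\<close>

lemma det_rank_one_update:
  fixes a :: "'r::idom" and c r :: "nat \<Rightarrow> 'r" and m :: "nat \<Rightarrow> nat \<Rightarrow> 'r"
  shows "det (mat n n (\<lambda>(i, j). m i j - s * c i * r j)) =
    (1 - s * a) * det (mat n n (\<lambda>(i, j). m i j)) +
    s * det (mat (Suc n) (Suc n) (\<lambda>(i, j). case_nat (case_nat a r j) (\<lambda>i. case_nat (c i) (m i) j) i))"
proof -
  \<comment> \<open>\<open>U\<close> performs the column operations that turn the bordered matrix \<open>N\<close> into \<open>V\<close>.\<close>
  define N where "N = mat (Suc n) (Suc n)
    (\<lambda>(i, j). case_nat (case_nat 1 (\<lambda>j. s * r j) j) (\<lambda>i. case_nat (c i) (m i) j) i)"
  define U where "U = mat (Suc n) (Suc n)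
    (\<lambda>(i, j). case_nat (case_nat 1 (\<lambda>j. - (s * r j)) j)
      (\<lambda>i. case_nat 0 (\<lambda>j. if i = j then 1 else (0::'r)) j) i)"
  define V where "V = mat (Suc n) (Suc n)
    (\<lambda>(i, j). case_nat (case_nat 1 (\<lambda>_. 0) j)
      (\<lambda>i. case_nat (c i) (\<lambda>j. m i j - s * c i * r j) j) i)"
  have "N * U = V"
    by (intro eq_matI)
      (auto simp: N_def U_def V_def scalar_prod_def atLeast0LessThan algebra_simps
        simp del: sum.lessThan_Suc split: nat.splits simp: sum.lessThan_Suc_shift if_distrib
        cong: if_cong)
  moreover have "det (N * U) = det N * det U"
    by (rule det_mult) (auto simp: N_def U_def)
  moreover have "det U = 1"
  proof -
    have "det U = prod_list (diag_mat U)"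
      by (rule det_upper_triangular[of _ "Suc n"]) (auto simp: U_def upper_triangular_def split: nat.splits)
    also have "\<dots> = 1"
      unfolding prod_list_diag_prod
      by (rule prod.neutral) (auto simp: U_def split: nat.splits)
    finally show ?thesis .
  qed
  moreover have "det V = det (mat n n (\<lambda>(i, j). m i j - s * c i * r j))"
    unfolding V_def det_laplace_first_row
    by (simp del: sum.lessThan_Suc add: sum.lessThan_Suc_shift)
  moreover have "det N = (1 - s * a) * det (mat n n (\<lambda>(i, j). m i j)) +
    s * det (mat (Suc n) (Suc n) (\<lambda>(i, j). case_nat (case_nat a r j) (\<lambda>i. case_nat (c i) (m i) j) i))"
    unfolding N_def det_laplace_first_row
    by (simp del: sum.lessThan_Suc add: sum.lessThan_Suc_shift sum_distrib_left algebra_simps)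
  ultimately show ?thesis by simp
qed

text \<open>
  In the Leibniz expansion of a principal minor the permutations with a fixed point, and the products
  of two 2-cycles, only involve smaller principal minors. Hence the sums of the products along full
  cycles agree as well; the following lemmas extract them up to length four.
\<close>

lemma principal_minors_2:
  assumes "determinantally_equivalent L A B" "x \<in> L" "y \<in> L"
  shows "A x x = B x x" "A x y * A y x = B x y * B y x"
proof -
  have diag: "A x x = B x x" if "x \<in> L" for x
    using assms(1)[unfolded determinantally_equivalent_def, rule_format, of 1 "\<lambda>_. x"] that
    by (simp add: det_single)
  then show "A x x = B x x" using assms by simp
  have "det (mat (Suc (Suc 0)) (Suc (Suc 0)) (\<lambda>(i, j). B ([x, y] ! i) ([x, y] ! j))) =
      det (mat (Suc (Suc 0)) (Suc (Suc 0)) (\<lambda>(i, j). A ([x, y] ! i) ([x, y] ! j)))"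
    using assms by (intro assms(1)[unfolded determinantally_equivalent_def, rule_format])
      (auto simp: less_Suc_eq)
  then show "A x y * A y x = B x y * B y x"
    unfolding det_laplace_first_row using diag assms by simp
qed

lemma principal_minors_3:
  assumes eq: "determinantally_equivalent L A B" and xyz: "x \<in> L" "y \<in> L" "z \<in> L"
  shows "A x y * A y z * A z x + A x z * A z y * A y x =
    B x y * B y z * B z x + B x z * B z y * B y x"
proof -
  have "det (mat (Suc (Suc (Suc 0))) (Suc (Suc (Suc 0))) (\<lambda>(i, j). B ([x, y, z] ! i) ([x, y, z] ! j))) =
      det (mat (Suc (Suc (Suc 0))) (Suc (Suc (Suc 0))) (\<lambda>(i, j). A ([x, y, z] ! i) ([x, y, z] ! j)))"
    using xyz by (intro eq[unfolded determinantally_equivalent_def, rule_format])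
      (auto simp: less_Suc_eq)
  then have "B x x * (B y y * B z z - B y z * B z y) - B x y * B y x * B z z - B x z * B z x * B y y
      + (B x y * B y z * B z x + B x z * B z y * B y x)
    = A x x * (A y y * A z z - A y z * A z y) - A x y * A y x * A z z - A x z * A z x * A y y
      + (A x y * A y z * A z x + A x z * A z y * A y x)"
    unfolding det_laplace_first_row by (simp add: algebra_simps)
  then show ?thesis
    using xyz by (simp add: principal_minors_2[OF eq])
qed

lemma principal_minors_4:
  assumes eq: "determinantally_equivalent L A B" and xyz: "x \<in> L" "y \<in> L" "z \<in> L" "w \<in> L"
  shows "A x y * A y z * A z w * A w x + A x w * A w z * A z y * A y x
       + A x z * A z w * A w y * A y x + A x y * A y w * A w z * A z x
       + A x w * A w y * A y z * A z x + A x z * A z y * A y w * A w x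
       = B x y * B y z * B z w * B w x + B x w * B w z * B z y * B y x
       + B x z * B z w * B w y * B y x + B x y * B y w * B w z * B z x
       + B x w * B w y * B y z * B z x + B x z * B z y * B y w * B w x"
proof -
  define cyc4 where "cyc4 h =
    h x y * h y z * h z w * h w x + h x w * h w z * h z y * h y x
       + h x z * h z w * h w y * h y x + h x y * h y w * h w z * h z x
       + h x w * h w y * h y z * h z x + h x z * h z y * h y w * h w x" for h :: "'a \<Rightarrow> 'a \<Rightarrow> 'b"
  define cyc3 where "cyc3 h x y z = h x y * h y z * h z x + h x z * h z y * h y x"
    for h :: "'a \<Rightarrow> 'a \<Rightarrow> 'b" and x y z
  have expand: "det (mat (Suc (Suc (Suc (Suc 0)))) (Suc (Suc (Suc (Suc 0))))
      (\<lambda>(i, j). h ([x, y, z, w] ! i) ([x, y, z, w] ! j)))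
    = h x x * h y y * h z z * h w w
      - (h x y * h y x) * h z z * h w w - (h x z * h z x) * h y y * h w w
      - (h x w * h w x) * h y y * h z z - (h y z * h z y) * h x x * h w w
      - (h y w * h w y) * h x x * h z z - (h z w * h w z) * h x x * h y y
      + (h x y * h y x) * (h z w * h w z) + (h x z * h z x) * (h y w * h w y)
      + (h x w * h w x) * (h y z * h z y)
      + cyc3 h x y z * h w w + cyc3 h x y w * h z z + cyc3 h x z w * h y y + cyc3 h y z w * h x x
      - cyc4 h" for h :: "'a \<Rightarrow> 'a \<Rightarrow> 'b"
    unfolding det_laplace_first_row cyc3_def cyc4_def by (simp add: algebra_simps)
  have "det (mat (Suc (Suc (Suc (Suc 0)))) (Suc (Suc (Suc (Suc 0))))
      (\<lambda>(i, j). B ([x, y, z, w] ! i) ([x, y, z, w] ! j))) =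
    det (mat (Suc (Suc (Suc (Suc 0)))) (Suc (Suc (Suc (Suc 0))))
      (\<lambda>(i, j). A ([x, y, z, w] ! i) ([x, y, z, w] ! j)))"
    using xyz by (intro eq[unfolded determinantally_equivalent_def, rule_format])
      (auto simp: less_Suc_eq)
  moreover have "cyc3 A a b c = cyc3 B a b c" if "a \<in> L" "b \<in> L" "c \<in> L" for a b c
    unfolding cyc3_def by (rule principal_minors_3[OF eq that])
  ultimately have "cyc4 A = cyc4 B"
    unfolding expand using xyz by (simp add: principal_minors_2[OF eq])
  then show ?thesis by (simp only: cyc4_def)
qed

section \<open>Nonzero entries: orientations of triangles\<close>

definition cycle3 where
  "cycle3 A x y z = A x y * A y z * (A z x :: 'f::field)"

lemma equal_sum_and_product:
  fixes a b c d :: "'r::idom"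
  assumes "a + b = c + d" "a * b = c * d"
  shows "a = c \<and> b = d \<or> a = d \<and> b = c"
proof -
  have "(a - c) * (a - d) = a * a - a * (c + d) + c * d"
    by (simp add: algebra_simps)
  also have "\<dots> = 0"
    unfolding assms[symmetric] by (simp add: algebra_simps)
  finally have "a = c \<or> a = d" by simp
  then show ?thesis using assms by auto
qed

text \<open>
  Read \<open>al, al'\<close>, \<open>be, be'\<close>, \<open>ga, ga'\<close> as the two cycle products of the three triangles through a base
  point of a tetrahedron, and \<open>p, q, r\<close> as the 2-cycle products at the base point. Then \<open>four\<close> is the
  sum over the 4-cycles and \<open>three\<close> the sum over the two orientations of the fourth face (up to a
  common factor); both are supposed to be unchanged when only \<open>al\<close> and \<open>al'\<close> are exchanged.
  The two sides of each equation differ by a multiple of \<open>al - al'\<close>; what remains after cancelling it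
  gives the relation once \<open>ga - ga'\<close> is cancelled as well.
\<close>

lemma swapping_one_edge_forces_relation:
  fixes al al' be be' ga ga' p q r :: "'f::field"
  assumes nz: "p \<noteq> 0" "q \<noteq> 0"
    and four: "(al * be + al' * be') / q + (be * ga + be' * ga') / r + (ga * al + ga' * al') / p
      = (al' * be + al * be') / q + (be * ga + be' * ga') / r + (ga * al' + ga' * al) / p"
    and three: "al * be * ga + al' * be' * ga' = al' * be * ga + al * be' * ga'"
    and ne: "al \<noteq> al'" "ga \<noteq> ga'"
  shows "p * be' = q * ga"
proof -
  have "(al - al') * (be * ga - be' * ga') =
      (al * be * ga + al' * be' * ga') - (al' * be * ga + al * be' * ga')"
    by (simp add: algebra_simps)
  then have bg: "be * ga = be' * ga'"
    using three ne by simp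
  have "(al - al') * ((be - be') / q + (ga - ga') / p) =
      ((al * be + al' * be') / q + (be * ga + be' * ga') / r + (ga * al + ga' * al') / p) -
      ((al' * be + al * be') / q + (be * ga + be' * ga') / r + (ga * al' + ga' * al) / p)"
    by (simp add: algebra_simps add_divide_distrib diff_divide_distrib)
  then have "(be - be') / q + (ga - ga') / p = 0"
    using four ne by simp
  then have sum0: "p * (be - be') + q * (ga - ga') = 0"
    using nz by (simp add: field_simps)
  have "(ga - ga') * (p * be' - q * ga) =
      p * (be * ga - be' * ga') - ga * (p * (be - be') + q * (ga - ga'))"
    by (simp add: algebra_simps)
  then show ?thesis
    using bg sum0 ne by simp
qed

lemma determinantally_equivalent_transpose:
  assumes "determinantally_equivalent L A B"
  shows "determinantally_equivalent L A (\<lambda>x y. B y x)"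
  unfolding determinantally_equivalent_def
proof (intro allI impI)
  fix n and x :: "nat \<Rightarrow> 'a" assume "\<forall>i<n. x i \<in> L"
  moreover have "mat n n (\<lambda>(i, j). B (x j) (x i)) = (mat n n (\<lambda>(i, j). B (x i) (x j)))\<^sup>T"
    by (intro eq_matI) auto
  ultimately show "det (mat n n (\<lambda>(i, j). B (x j) (x i))) = det (mat n n (\<lambda>(i, j). A (x i) (x j)))"
    using assms by (simp add: determinantally_equivalent_def det_transpose[where n = n])
qed

locale nonzero_pair =
  fixes L :: "'a set" and A B :: "'a \<Rightarrow> 'a \<Rightarrow> 'f::field"
  assumes det_eq: "determinantally_equivalent L A B"
    and nonzero: "\<And>x y. x \<in> L \<Longrightarrow> y \<in> L \<Longrightarrow> x \<noteq> y \<Longrightarrow> A x y \<noteq> 0"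
    and class_D: "class_D L A"
begin

text \<open>
  The two orientations of a triangle have cycle products with the same sum and the same product for
  \<open>A\<close> and for \<open>B\<close>, so \<open>B\<close> either keeps the pair of values of \<open>A\<close> or exchanges them. Both happen at
  once when the two values are equal.
\<close>

definition preserved where "preserved x y z \<longleftrightarrow> cycle3 B x y z = cycle3 A x y z"
definition reversed where "reversed x y z \<longleftrightarrow> cycle3 B x y z = cycle3 A x z y"

lemma nonzero_B: "x \<in> L \<Longrightarrow> y \<in> L \<Longrightarrow> x \<noteq> y \<Longrightarrow> B x y \<noteq> 0"
  using principal_minors_2(2)[OF det_eq, of x y] nonzero[of x y] nonzero[of y x] by force

lemma triple:
  assumes "x \<in> L" "y \<in> L" "z \<in> L"
  shows "preserved x y z \<and> preserved x z y \<or> reversed x y z \<and> reversed x z y"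
proof -
  have "cycle3 B x y z + cycle3 B x z y = cycle3 A x y z + cycle3 A x z y"
    using principal_minors_3[OF det_eq assms] by (simp add: cycle3_def)
  moreover have "cycle3 B x y z * cycle3 B x z y = cycle3 A x y z * cycle3 A x z y"
  proof -
    have "cycle3 h x y z * cycle3 h x z y = (h x y * h y x) * (h y z * h z y) * (h x z * h z x)"
      for h :: "'a \<Rightarrow> 'a \<Rightarrow> 'f"
      by (simp add: cycle3_def algebra_simps)
    then show ?thesis
      using assms by (simp add: principal_minors_2(2)[OF det_eq])
  qed
  ultimately show ?thesis
    unfolding preserved_def reversed_def by (rule equal_sum_and_product)
qed

text \<open>
  This is how class D decides between the two orientations: the relation that is forced when a single
  triangle is reversed and the products of another one differ is, up to nonzero factors, the vanishing
  of a \<open>2 \<times> 2\<close> minor of \<open>A\<close>.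
\<close>

lemma four_points_core:
  assumes L: "x \<in> L" "y \<in> L" "z \<in> L" "w \<in> L" and dist: "distinct [x, y, z, w]"
    and rev: "reversed x y z" "reversed x z y"
    and pres: "preserved x z w" "preserved x w z" "preserved x y w" "preserved x w y"
    and ne: "\<not> preserved x y z" "\<not> reversed x y w"
  shows False
proof -
  note minors2 = principal_minors_2(2)[OF det_eq]
  have nz: "h x y \<noteq> 0" "h y x \<noteq> 0" "h x z \<noteq> 0" "h z x \<noteq> 0" "h x w \<noteq> 0" "h w x \<noteq> 0"
    if "h = A \<or> h = B" for h
    using that L dist nonzero nonzero_B by auto
  \<comment> \<open>The cycles of length three off \<open>x\<close> and those of length four, in terms of the triangles at \<open>x\<close>.\<close>
  have three: "cycle3 h x y z * cycle3 h x z w * cycle3 h x w y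
      + cycle3 h x z y * cycle3 h x w z * cycle3 h x y w
    = (h x y * h y x) * (h x z * h z x) * (h x w * h w x)
      * (h y z * h z w * h w y + h y w * h w z * h z y)" for h :: "'a \<Rightarrow> 'a \<Rightarrow> 'f"
    by (simp add: cycle3_def algebra_simps)
  have four: "(cycle3 h x y z * cycle3 h x z w + cycle3 h x z y * cycle3 h x w z) / (h x z * h z x)
      + (cycle3 h x z w * cycle3 h x w y + cycle3 h x w z * cycle3 h x y w) / (h x w * h w x)
      + (cycle3 h x w y * cycle3 h x y z + cycle3 h x y w * cycle3 h x z y) / (h x y * h y x)
    = h x y * h y z * h z w * h w x + h x w * h w z * h z y * h y x
       + h x z * h z w * h w y * h y x + h x y * h y w * h w z * h z x
       + h x w * h w y * h y z * h z x + h x z * h z y * h y w * h w x"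
    if "h = A \<or> h = B" for h :: "'a \<Rightarrow> 'a \<Rightarrow> 'f"
    using nz[OF that] by (simp add: cycle3_def field_simps)
  let ?C = "cycle3 A x"
  have "(A x y * A y x) * ?C w z = (A x z * A z x) * ?C w y"
  proof (rule swapping_one_edge_forces_relation)
    show "A x y * A y x \<noteq> 0" "A x z * A z x \<noteq> 0"
      using nz[of A] by auto
    show "?C y z * ?C z w * ?C w y + ?C z y * ?C w z * ?C y w =
      ?C z y * ?C z w * ?C w y + ?C y z * ?C w z * ?C y w"
      using three[of A] three[of B] rev pres minors2[of x y] minors2[of x z] minors2[of x w] L
        principal_minors_3[OF det_eq, of y z w]
      by (simp add: preserved_def reversed_def)
    show "(?C y z * ?C z w + ?C z y * ?C w z) / (A x z * A z x)
      + (?C z w * ?C w y + ?C w z * ?C y w) / (A x w * A w x)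
      + (?C w y * ?C y z + ?C y w * ?C z y) / (A x y * A y x)
      = (?C z y * ?C z w + ?C y z * ?C w z) / (A x z * A z x)
      + (?C z w * ?C w y + ?C w z * ?C y w) / (A x w * A w x)
      + (?C w y * ?C z y + ?C y w * ?C y z) / (A x y * A y x)"
      using four[of A] four[of B] rev pres minors2[of x y] minors2[of x z] minors2[of x w] L
        principal_minors_4[OF det_eq L]
      by (simp add: preserved_def reversed_def)
    show "?C y z \<noteq> ?C z y" using ne rev by (simp add: preserved_def reversed_def)
    show "?C w y \<noteq> ?C y w" using ne pres by (simp add: preserved_def reversed_def)
  qed
  then have "(A y x * A x w * A z x) * (A x y * A w z - A x z * A w y) = 0"
    by (simp add: cycle3_def algebra_simps)
  then have "A x y * A w z - A x z * A w y = 0"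
    using nz[of A] by simp
  then show False using class_D L dist by (auto simp: class_D_def)
qed

lemma nonzero_pair_transpose: "nonzero_pair L A (\<lambda>x y. B y x)"
  by unfold_locales
    (use det_eq nonzero class_D in \<open>auto intro: determinantally_equivalent_transpose\<close>)

text \<open>
  The third triangle \<open>xzw\<close> at \<open>x\<close> is either preserved or reversed. In the second case two of the three
  triangles are reversed, and passing from \<open>B\<close> to its transpose leaves a single reversed one.
\<close>

lemma four_points:
  assumes L: "x \<in> L" "y \<in> L" "z \<in> L" "w \<in> L" and dist: "distinct [x, y, z, w]"
  shows "preserved x y z \<or> reversed x y w"
proof (rule ccontr)
  interpret T: nonzero_pair L A "\<lambda>x y. B y x"
    by (rule nonzero_pair_transpose)
  have T: "T.preserved a b c \<longleftrightarrow> reversed a c b" "T.reversed a b c \<longleftrightarrow> preserved a c b" for a b c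
    by (auto simp: T.preserved_def T.reversed_def preserved_def reversed_def cycle3_def mult_ac)
  assume "\<not> (preserved x y z \<or> reversed x y w)"
  then have ne: "\<not> preserved x y z" "\<not> reversed x y w" by auto
  then have *: "reversed x y z" "reversed x z y" "preserved x y w" "preserved x w y"
    using triple[of x y z] triple[of x y w] L by auto
  have ne': "\<not> preserved x z y" "\<not> reversed x w y"
    using ne * by (auto simp: preserved_def reversed_def)
  consider "preserved x z w \<and> preserved x w z" | "reversed x z w \<and> reversed x w z"
    using triple[of x z w] L by auto
  then show False
  proof cases
    case 1
    then show False using four_points_core[of x y z w] L dist * ne by auto
  next
    case 2
    then show False
      using T.four_points_core[of x y w z] L dist * ne' by (auto simp: T)
  qed
qed

lemma triples_through_edge:
  assumes L: "x \<in> L" "y \<in> L" "z \<in> L" "w \<in> L"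
    and dist: "distinct [x, y, z]" "distinct [x, y, w]"
  shows "preserved x y z \<or> reversed x y w"
  using four_points[of x y z w] triple[of x y z] assms by (cases "z = w") auto

text \<open>
  Suppose that \<open>pyz\<close> is not preserved and \<open>pvw\<close> is not reversed. Two such triangles cannot share an
  edge, so \<open>y, z, v, w\<close> are distinct and every triangle consisting of \<open>p\<close>, one of \<open>y, z\<close> and one of
  \<open>v, w\<close> is both preserved and reversed. The product of the cycles of the three triangles at \<open>p\<close> over
  a triangle \<open>abc\<close> is the cycle of \<open>abc\<close> times 2-cycles. Therefore \<open>yvz\<close> inherits its behaviour from
  \<open>pyz\<close>, and \<open>yvw\<close> from \<open>pvw\<close>; but these two share the edge \<open>yv\<close>.
\<close>

lemma preserved_or_reversed_at_base:
  assumes "p \<in> L"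
  shows "(\<forall>y\<in>L. \<forall>z\<in>L. distinct [p, y, z] \<longrightarrow> preserved p y z) \<or>
    (\<forall>y\<in>L. \<forall>z\<in>L. distinct [p, y, z] \<longrightarrow> reversed p y z)"
proof (rule ccontr)
  assume "\<not> ?thesis"
  then obtain y z v w where L: "y \<in> L" "z \<in> L" "v \<in> L" "w \<in> L"
    and dist: "distinct [p, y, z]" "distinct [p, v, w]"
    and np: "\<not> preserved p y z" and nr: "\<not> reversed p v w" by blast
  note L = L assms
  have swap: "preserved p a b \<longleftrightarrow> preserved p b a" "reversed p a b \<longleftrightarrow> reversed p b a"
    if "a \<in> L" "b \<in> L" for a b
    using triple[of p a b] that L by (auto simp: preserved_def reversed_def)
  note np' = np[unfolded swap(1)[OF L(1,2)]] and nr' = nr[unfolded swap(2)[OF L(3,4)]]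
  have disj: "y \<noteq> v" "y \<noteq> w" "z \<noteq> v" "z \<noteq> w"
    using triples_through_edge[of p y z w] triples_through_edge[of p y z v]
      triples_through_edge[of p z y w] triples_through_edge[of p z y v] L dist np nr np' nr'
    by auto
  have sym: "preserved p a b \<and> reversed p a b"
    if "a \<in> {y, z} \<and> b \<in> {v, w}" for a b
  proof
    show "reversed p a b"
      using that triples_through_edge[of p y z b] triples_through_edge[of p z y b] L dist disj np np'
      by auto
    have "preserved p b a"
      using that triples_through_edge[of p v a w] triples_through_edge[of p w a v] L dist disj nr nr'
      by auto
    then show "preserved p a b"
      using that L swap by auto
  qed
  have sym': "cycle3 B p a b = cycle3 A p a b" "cycle3 A p b a = cycle3 A p a b"
      "cycle3 B p b a = cycle3 A p a b"
    if "a \<in> {y, z}" "b \<in> {v, w}" for a b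
  proof -
    have "a \<in> L" "b \<in> L" using that L by auto
    then show "cycle3 B p a b = cycle3 A p a b" "cycle3 A p b a = cycle3 A p a b"
      "cycle3 B p b a = cycle3 A p a b"
      using sym[of a b] swap[of a b] that by (auto simp: preserved_def reversed_def)
  qed
  define P where "P a b c = (A p a * A a p) * (A p b * A b p) * (A p c * A c p)" for a b c
  have cocycle: "cycle3 h a b c * P a b c = cycle3 h p a b * cycle3 h p b c * cycle3 h p c a"
    if "h = A \<or> h = B" "a \<in> L" "b \<in> L" "c \<in> L" for h a b c
  proof -
    have "cycle3 h a b c * ((h p a * h a p) * (h p b * h b p) * (h p c * h c p)) =
        cycle3 h p a b * cycle3 h p b c * cycle3 h p c a"
      by (simp add: cycle3_def algebra_simps)
    moreover have "h p b * h b p = A p b * A b p" if "b \<in> L" for b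
      using \<open>h = A \<or> h = B\<close> principal_minors_2(2)[OF det_eq, of p b] that L by auto
    ultimately show ?thesis using that by (simp add: P_def)
  qed
  have cyc_nz: "cycle3 A p a b \<noteq> 0" if "a \<in> L" "b \<in> L" "distinct [p, a, b]" for a b
    using that L nonzero by (auto simp: cycle3_def)
  have "\<not> preserved y v z"
  proof
    assume "preserved y v z"
    then have "cycle3 A p y v * cycle3 A p v z * cycle3 A p z y =
        cycle3 B p y v * cycle3 B p v z * cycle3 B p z y"
      using cocycle[of A y v z] cocycle[of B y v z] L by (simp add: preserved_def)
    then have "cycle3 A p z y = cycle3 B p z y"
      using sym'[of y v] sym'[of z v] cyc_nz[of y v] cyc_nz[of z v] L dist disj by auto
    then show False using np' by (simp add: preserved_def)
  qed
  moreover have "\<not> reversed y v w"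
  proof
    assume "reversed y v w"
    then have "cycle3 B p y v * cycle3 B p v w * cycle3 B p w y =
        cycle3 A p y w * cycle3 A p w v * cycle3 A p v y"
      using cocycle[of B y v w] cocycle[of A y w v] L by (simp add: reversed_def P_def mult_ac)
    then have "cycle3 B p v w = cycle3 A p w v"
      using sym'[of y v] sym'[of y w] cyc_nz[of y v] cyc_nz[of y w] L dist disj by auto
    then show False using nr by (simp add: reversed_def)
  qed
  ultimately show False
    using triples_through_edge[of y v z w] L dist disj by auto
qed

text \<open>
  The conjugating function is forced by the entries of the column of \<open>p\<close>. The entry at \<open>(x, y)\<close> then
  follows from the triangle \<open>pxy\<close>.
\<close>

lemma conjugation_if_preserved:
  assumes p: "p \<in> L" and pres: "\<forall>y\<in>L. \<forall>z\<in>L. distinct [p, y, z] \<longrightarrow> preserved p y z"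
  shows "conjugation_transformation L A B"
proof -
  define g where "g x = (if x = p then 1 else B x p * inverse (A x p))" for x
  have g: "g x \<noteq> 0" if "x \<in> L" for x
    using that p nonzero[of x p] nonzero_B[of x p] by (simp add: g_def)
  have eq: "B x y * g y = g x * A x y" if L: "x \<in> L" "y \<in> L" for x y
  proof -
    consider "x = y" | "x \<noteq> y" "y = p" | "x \<noteq> y" "x = p" | "distinct [p, x, y]" by auto
    then show ?thesis
    proof cases
      case 1
      then show ?thesis using principal_minors_2(1)[OF det_eq, of x x] L by simp
    next
      case 2
      then show ?thesis using nonzero[of x p] L p by (simp add: g_def)
    next
      case 3
      then show ?thesis
        using nonzero[of y p] L p principal_minors_2(2)[OF det_eq, of p y]
        by (simp add: g_def field_simps)
    next
      case 4
      have nz: "A x p \<noteq> 0" "A y p \<noteq> 0" "B p x \<noteq> 0"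
        using 4 nonzero nonzero_B L p by auto
      have "B p x * B x y * B y p = A p x * A x y * A y p"
        using pres 4 L by (auto simp: preserved_def cycle3_def)
      moreover have "A p x * A x p = B p x * B x p"
        using principal_minors_2(2)[OF det_eq] L p by auto
      ultimately have "B p x * (B x y * B y p * A x p) = B p x * (A x y * A y p * B x p)"
        by (metis (no_types, lifting) mult.assoc mult.commute)
      then have "B x y * B y p * A x p = A x y * A y p * B x p" using nz by simp
      then show ?thesis using nz 4 by (auto simp: g_def field_simps)
    qed
  qed
  have "B x y = g x * A x y * inverse (g y)" if "x \<in> L" "y \<in> L" for x y
    using eq[OF that] g[OF that(2)] by (simp add: field_simps)
  then show ?thesis
    using g unfolding conjugation_transformation_def by blast
qed

lemma conjugation_up_to_transposition:
  "conjugation_transformation L A B \<or> conjugation_transformation L A (\<lambda>x y. B y x)"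
proof (cases "L = {}")
  case True
  then show ?thesis by (simp add: conjugation_transformation_def)
next
  case False
  then obtain p where p: "p \<in> L" by blast
  interpret T: nonzero_pair L A "\<lambda>x y. B y x"
    by (rule nonzero_pair_transpose)
  have "T.preserved p y z" if "y \<in> L" "z \<in> L" "reversed p y z" for y z
    using that triple[of p y z] p
    by (auto simp: T.preserved_def preserved_def reversed_def cycle3_def mult_ac)
  then show ?thesis
    using preserved_or_reversed_at_base[OF p] conjugation_if_preserved[OF p]
      T.conjugation_if_preserved[OF p] by blast
qed

end

section \<open>Pivoting with an indeterminate\<close>

abbreviation const :: "'f::field \<Rightarrow> 'f poly fract" where
  "const c \<equiv> to_fract [:c:]"

lemma const_hom: "const (a + b) = const a + const b" "const (a * b) = const a * const b"
  "const 0 = 0" "const 1 = 1"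
  by (simp_all flip: to_fract_add to_fract_mult to_fract_1 one_poly_def add: one_pCons)

interpretation const: field_hom "const :: 'f::field \<Rightarrow> 'f poly fract"
  by unfold_locales (simp_all add: const_hom)

lemma const_inj [simp]: "const a = const b \<longleftrightarrow> a = b"
  by simp

definition indet :: "'f::field poly fract" where "indet = to_fract [:0, 1:]"

lemma const_eq_indet_mult_const: "const a = indet * const b \<longleftrightarrow> a = 0 \<and> b = 0"
  by (auto simp: indet_def simp flip: to_fract_mult)

text \<open>
  A rank one update by the column and the row of \<open>v\<close>, with an indeterminate coefficient; on the other
  points it is the Schur complement of \<open>v\<close> after the diagonal entry at \<open>v\<close> has been replaced by a
  suitable indeterminate. The entries are taken in the field of rational functions so that the
  indeterminate satisfies no relation with the entries of \<open>A\<close>.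
\<close>

definition pivot :: "'a \<Rightarrow> ('a \<Rightarrow> 'a \<Rightarrow> 'f::field) \<Rightarrow> 'a \<Rightarrow> 'a \<Rightarrow> 'f poly fract" where
  "pivot v A x y = const (A x y) - indet * (const (A x v) * const (A v y))"

text \<open>
  A zero survives only if the path through \<open>v\<close> vanishes too. This is why a pivot removes zeros.
\<close>

lemma pivot_eq_0_iff: "pivot v A x y = 0 \<longleftrightarrow> A x y = 0 \<and> A x v * A v y = 0"
  using const_eq_indet_mult_const[of "A x y" "A x v * A v y"]
  by (simp add: pivot_def const_hom del: const.hom_mult)

text \<open>
  The principal minors of a pivot are expressed by principal minors of \<open>A\<close>, which is why pivoting
  respects determinantal equivalence.
\<close>

lemma det_pivot:
  "det (mat n n (\<lambda>(i, j). pivot v A (x i) (x j))) =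
    (1 - indet * const (A v v)) * const (det (mat n n (\<lambda>(i, j). A (x i) (x j)))) +
    indet * const (det (mat (Suc n) (Suc n) (\<lambda>(i, j). A (case_nat v x i) (case_nat v x j))))"
proof -
  have hom: "const (det (mat k k f)) = det (mat k k (\<lambda>ij. const (f ij)))" for k f
    unfolding const.hom_det[symmetric] by (rule arg_cong[of _ _ det]) (auto intro!: eq_matI)
  show ?thesis
    unfolding hom using det_rank_one_update[of n "\<lambda>i j. const (A (x i) (x j))" indet
      "\<lambda>i. const (A (x i) v)" "\<lambda>j. const (A v (x j))" "const (A v v)"]
    by (auto simp: pivot_def mult.assoc case_prod_unfold
        intro!: arg_cong2[of _ _ _ _ "(+)"] arg_cong[of _ _ det] eq_matI split: nat.splits)
qed

lemma determinantally_equivalent_pivot: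
  assumes eq: "determinantally_equivalent L A B" and v: "v \<in> L"
  shows "determinantally_equivalent L (pivot v A) (pivot v B)"
  unfolding determinantally_equivalent_def
proof (intro allI impI)
  fix n and x :: "nat \<Rightarrow> 'a" assume x: "\<forall>i<n. x i \<in> L"
  have "\<forall>i<Suc n. case_nat v x i \<in> L"
    using x v by (auto split: nat.splits)
  then show "det (mat n n (\<lambda>(i, j). pivot v B (x i) (x j))) =
      det (mat n n (\<lambda>(i, j). pivot v A (x i) (x j)))"
    unfolding det_pivot using eq x principal_minors_2(1)[OF eq v v]
    by (simp add: determinantally_equivalent_def)
qed

text \<open>
  The part of a \<open>2 \<times> 2\<close> minor that is quadratic in the indeterminate is a minor of a matrix of rank
  one, so it vanishes. What is left is linear in the indeterminate, and its constant term is the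
  corresponding minor of \<open>A\<close>.
\<close>

lemma class_D_pivot:
  assumes "class_D L A"
  shows "class_D L (pivot v A)"
  unfolding class_D_def
proof (intro ballI impI)
  fix x y z w assume *: "x \<in> L" "y \<in> L" "z \<in> L" "w \<in> L" "distinct [x, y, z, w]"
  let ?m = "A x y * A w z - A x z * A w y"
  let ?k = "A x y * (A w v * A v z) + A x v * A v y * A w z
    - A x z * (A w v * A v y) - A x v * A v z * A w y"
  have "pivot v A x y * pivot v A w z - pivot v A x z * pivot v A w y =
      const ?m - indet * const ?k"
    by (simp only: pivot_def const.hom_minus const_hom, simp only: algebra_simps)
  moreover have "?m \<noteq> 0" using assms * by (auto simp: class_D_def)
  ultimately show "pivot v A x y * pivot v A w z - pivot v A x z * pivot v A w y \<noteq> 0"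
    using const_eq_indet_mult_const[of ?m ?k] by simp
qed

section \<open>Zeros of functions of class D\<close>

text \<open>
  Among four points a row or a column of a function of class D has at most one off-diagonal zero,
  because two of them make a \<open>2 \<times> 2\<close> minor vanish. The hypothesis \<open>big\<close> says that there are four points,
  for finite and infinite \<open>L\<close> alike.
\<close>

lemma class_D_zero:
  assumes D: "class_D L A" and big: "\<And>x y v. \<exists>w\<in>L. w \<notin> {x, y, v}"
    and L: "x \<in> L" "y \<in> L" "v \<in> L" and dist: "distinct [x, y, v]" and zero: "A x y = 0"
  shows "A x v \<noteq> 0" "A v y \<noteq> 0"
proof -
  obtain w where w: "w \<in> L" "w \<notin> {x, y, v}" using big by blast
  have "A x y * A w v - A x v * A w y \<noteq> 0" "A x y * A v w - A x w * A v y \<noteq> 0"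
    using D L dist w unfolding class_D_def by (auto 4 3)
  then show "A x v \<noteq> 0" "A v y \<noteq> 0" using zero by auto
qed

section \<open>Undoing a pivot\<close>

text \<open>
  Pivoting multiplies the row and the column of \<open>v\<close> by the nonzero factor \<open>1 - X a\<close>, where \<open>X\<close> is the
  indeterminate and \<open>a\<close> the common diagonal entry at \<open>v\<close>. Hence those entries can be read off from
  the pivot, and then the rank one update can be undone.
\<close>

lemma conjugation_of_pivot:
  fixes g :: "'a \<Rightarrow> 'f::field poly fract"
  assumes v: "v \<in> L" and diag: "B v v = A v v"
    and conj: "\<And>x y. x \<in> L \<Longrightarrow> y \<in> L \<Longrightarrow> pivot v B x y * g y = g x * pivot v A x y"
    and L: "x \<in> L" "y \<in> L" and g: "\<And>x. x \<in> L \<Longrightarrow> g x \<noteq> 0"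
  shows "const (B x y) * g y = g x * const (A x y)"
proof -
  define e where "e = 1 - indet * const (A v v)"
  have e: "e \<noteq> 0"
    using const_eq_indet_mult_const[of 1 "A v v"] by (simp add: e_def)
  have col: "pivot v h x v = const (h x v) * e" and row: "pivot v h v x = e * const (h v x)"
    if "h v v = A v v" for h x
    using that by (simp_all add: pivot_def e_def algebra_simps)
  have "e * (const (B x v) * g v) = e * (g x * const (A x v))"
    using conj[OF L(1) v] by (simp add: col diag mult_ac)
  then have 1: "const (B x v) * g v = g x * const (A x v)" using e by simp
  have "e * (const (B v y) * g y) = e * (g v * const (A v y))"
    using conj[OF v L(2)] by (simp add: row diag mult_ac)
  then have 2: "const (B v y) * g y = g v * const (A v y)" using e by simp
  have "g v * (const (B x v) * const (B v y) * g y) = (const (B x v) * g v) * (const (B v y) * g y)"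
    by (simp add: mult_ac)
  also have "\<dots> = g v * (g x * (const (A x v) * const (A v y)))"
    unfolding 1 2 by (simp add: mult_ac)
  finally have "const (B x v) * const (B v y) * g y = g x * (const (A x v) * const (A v y))"
    using g[OF v] by simp
  with conj[OF L] show ?thesis
    by (simp add: pivot_def algebra_simps)
qed

text \<open>
  The conjugating function takes values among the rational functions. Its values relative to a fixed
  point \<open>p\<close> are nevertheless constants: they are quotients of entries at \<open>(x, p)\<close>, or, if \<open>A x p = 0\<close>,
  products of such quotients along a path from \<open>x\<close> to \<open>p\<close> through a third point.
\<close>

lemma conjugation_descends:
  fixes A B :: "'a \<Rightarrow> 'a \<Rightarrow> 'f::field" and g :: "'a \<Rightarrow> 'f poly fract"
  assumes D: "class_D L A" and big: "\<And>x y v. \<exists>w\<in>L. w \<notin> {x, y, v}"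
    and conj: "\<And>x y. x \<in> L \<Longrightarrow> y \<in> L \<Longrightarrow> const (B x y) * g y = g x * const (A x y)"
    and g: "\<And>x. x \<in> L \<Longrightarrow> g x \<noteq> 0"
  shows "conjugation_transformation L A B"
proof -
  obtain p where p: "p \<in> L" using big by blast
  have step: "g x / g y = const (B x y / A x y)" if "x \<in> L" "y \<in> L" "A x y \<noteq> 0" for x y
    using conj[OF that(1,2)] g that by (simp add: field_simps const.hom_div)
  have "\<exists>c. g x / g p = const c" if x: "x \<in> L" for x
  proof (cases "x = p \<or> A x p \<noteq> 0")
    case True
    then show ?thesis using step[OF x p] g[OF p] const_hom(4) by (metis divide_self)
  next
    case False
    obtain z where z: "z \<in> L" "z \<notin> {x, p, p}" using big by blast
    then have "A x z \<noteq> 0" "A z p \<noteq> 0"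
      using class_D_zero[OF D big x p, of z] False by auto
    then have "g x / g z * (g z / g p) = const (B x z / A x z) * const (B z p / A z p)"
      using step x z p by simp
    then have "g x / g p = const (B x z / A x z * (B z p / A z p))"
      using g[OF z(1)] unfolding const_hom(2) by simp
    then show ?thesis by blast
  qed
  then obtain c where c: "\<And>x. x \<in> L \<Longrightarrow> g x / g p = const (c x)" by metis
  have c0: "c x \<noteq> 0" if "x \<in> L" for x
    using c[OF that] g[OF that] g[OF p] by auto
  have "B x y = c x * A x y * inverse (c y)" if "x \<in> L" "y \<in> L" for x y
  proof -
    have "const (B x y) * (g y / g p) = g x / g p * const (A x y)"
      using conj[OF that] by simp
    then have "const (B x y * c y) = const (c x * A x y)"
      using c that by (simp add: const_hom)
    then have "B x y * c y = c x * A x y" by (simp only: const_inj)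
    then show ?thesis using c0[OF that(2)] by (simp add: field_simps)
  qed
  then show ?thesis
    using c0 unfolding conjugation_transformation_def by blast
qed

lemma conjugation_transformation_from_pivot:
  fixes A B :: "'a \<Rightarrow> 'a \<Rightarrow> 'f::field"
  assumes D: "class_D L A" and big: "\<And>x y v. \<exists>w\<in>L. w \<notin> {x, y, v}"
    and v: "v \<in> L" and diag: "B v v = A v v"
    and conj: "conjugation_transformation L (pivot v A) (pivot v B)"
  shows "conjugation_transformation L A B"
proof -
  obtain g where g: "\<And>x. x \<in> L \<Longrightarrow> g x \<noteq> 0"
    and eq: "\<And>x y. x \<in> L \<Longrightarrow> y \<in> L \<Longrightarrow> pivot v B x y = g x * pivot v A x y * inverse (g y)"
    using conj unfolding conjugation_transformation_def by blast
  have "pivot v B x y * g y = g x * pivot v A x y" if "x \<in> L" "y \<in> L" for x y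
    using eq[OF that] g[OF that(2)] by simp
  then have "const (B x y) * g y = g x * const (A x y)" if "x \<in> L" "y \<in> L" for x y
    using conjugation_of_pivot[where v = v and L = L and g = g] v diag g that by metis
  then show ?thesis
    using conjugation_descends[where A = A and B = B and g = g and L = L] D big g by metis
qed

lemma pivot_transpose: "pivot v (\<lambda>x y. A y x) = (\<lambda>x y. pivot v A y x)"
  by (auto simp: pivot_def fun_eq_iff mult_ac)

section \<open>Removing all zeros\<close>

text \<open>
  The row and the column of \<open>v\<close> together exclude at most two of the three or more other points.
\<close>

lemma two_way_nonzero_pair:
  assumes D: "class_D L A" and big: "\<And>x y v. \<exists>w\<in>L. w \<notin> {x, y, v}"
  obtains u v where "u \<in> L" "v \<in> L" "u \<noteq> v" "A u v \<noteq> 0" "A v u \<noteq> 0"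
proof -
  obtain v where v: "v \<in> L" using big by blast
  obtain p where p: "p \<in> L" "p \<noteq> v" using big[of v v v] by blast
  obtain q where q: "q \<in> L" "q \<noteq> v" "q \<noteq> p" using big[of v p p] by blast
  obtain r where r: "r \<in> L" "r \<noteq> v" "r \<noteq> p" "r \<noteq> q" using big[of v p q] by blast
  have row: "A v y \<noteq> 0 \<or> A v z \<noteq> 0" and col: "A y v \<noteq> 0 \<or> A z v \<noteq> 0"
    if "y \<in> L" "z \<in> L" "distinct [v, y, z]" for y z
    using that class_D_zero(1)[OF D big v that(1,2)] class_D_zero(2)[OF D big that(1) v that(2)] v by auto
  have rows: "A v p \<noteq> 0 \<or> A v q \<noteq> 0" "A v q \<noteq> 0 \<or> A v r \<noteq> 0" "A v p \<noteq> 0 \<or> A v r \<noteq> 0"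
    and cols: "A p v \<noteq> 0 \<or> A q v \<noteq> 0" "A q v \<noteq> 0 \<or> A r v \<noteq> 0" "A p v \<noteq> 0 \<or> A r v \<noteq> 0"
    using row[OF p(1) q(1)] row[OF q(1) r(1)] row[OF p(1) r(1)]
      col[OF p(1) q(1)] col[OF q(1) r(1)] col[OF p(1) r(1)] p q r by simp_all
  have "A p v \<noteq> 0 \<and> A v p \<noteq> 0 \<or> A q v \<noteq> 0 \<and> A v q \<noteq> 0 \<or> A r v \<noteq> 0 \<and> A v r \<noteq> 0"
    using rows cols by argo
  then show thesis using that v p q r by auto
qed

text \<open>
  After a pivot at \<open>v\<close> the off-diagonal zeros lie in the row or the column of \<open>v\<close>, since elsewhere a
  zero of \<open>A\<close> has a nonzero path through \<open>v\<close>. A pivot at \<open>u\<close> then treats these zeros in the same way,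
  but it leaves the zeros in the row and the column of \<open>u\<close>. As \<open>u\<close> and \<open>v\<close> are joined by nonzero
  entries in both directions, there are none.
\<close>

lemma conjugation_up_to_transposition_if_class_D:
  fixes A B :: "'a \<Rightarrow> 'a \<Rightarrow> 'f::field"
  assumes eq: "determinantally_equivalent L A B" and D: "class_D L A"
    and big: "\<And>x y v. \<exists>w\<in>L. w \<notin> {x, y, v}"
  shows "conjugation_transformation L A B \<or> conjugation_transformation L A (\<lambda>x y. B y x)"
proof -
  obtain u v where uv: "u \<in> L" "v \<in> L" "u \<noteq> v" "A u v \<noteq> 0" "A v u \<noteq> 0"
    using two_way_nonzero_pair[OF D big] .
  note eq1 = determinantally_equivalent_pivot[OF eq uv(2)]
  note eq2 = determinantally_equivalent_pivot[OF eq1 uv(1)]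
  note D1 = class_D_pivot[OF D, of v]
  note D2 = class_D_pivot[OF D1, of u]
  have "pivot u (pivot v A) x y \<noteq> 0" if xy: "x \<in> L" "y \<in> L" "x \<noteq> y" for x y
  proof
    assume "pivot u (pivot v A) x y = 0"
    then have zero: "A x y = 0" "A x v * A v y = 0" "pivot v A x y = 0" "pivot v A x u * pivot v A u y = 0"
      by (simp_all add: pivot_eq_0_iff)
    show False
    proof (cases "x = u \<or> y = u")
      case True
      then have "x \<noteq> v" "y \<noteq> v" using zero uv by auto
      then show False
        using zero(2) class_D_zero[OF D big xy(1,2) uv(2)] xy zero(1) by auto
    next
      case False
      then show False
        using zero(4) class_D_zero[OF D1 big xy(1,2) uv(1)] xy zero(3) by auto
    qed
  qed
  then interpret nonzero_pair L "pivot u (pivot v A)" "pivot u (pivot v B)"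
    using eq2 D2 by unfold_locales
  \<comment> \<open>Both pivots are undone in reverse order, for \<open>B\<close> as well as for its transpose.\<close>
  have diag: "B x x = A x x" "pivot v B x x = pivot v A x x" if "x \<in> L" for x
    using principal_minors_2(1)[OF eq, of x x] principal_minors_2(1)[OF eq1, of x x] that by auto
  have descend: "conjugation_transformation L A B'"
    if "conjugation_transformation L (pivot u (pivot v A)) (pivot u (pivot v B'))"
      "\<And>x. x \<in> L \<Longrightarrow> B' x x = A x x" "\<And>x. x \<in> L \<Longrightarrow> pivot v B' x x = pivot v A x x" for B'
    using conjugation_transformation_from_pivot[OF D big uv(2) that(2)[OF uv(2)]
      conjugation_transformation_from_pivot[OF D1 big uv(1) that(3)[OF uv(1)] that(1)]] .
  have "pivot u (pivot v (\<lambda>x y. B y x)) = (\<lambda>x y. pivot u (pivot v B) y x)"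
    by (simp only: pivot_transpose[of v B] pivot_transpose[of u "pivot v B"])
  moreover have "pivot v (\<lambda>x y. B y x) x x = pivot v A x x" if "x \<in> L" for x
    using diag(2)[OF that] by (simp only: pivot_transpose[of v B])
  ultimately show ?thesis
    using conjugation_up_to_transposition descend[of B] descend[of "\<lambda>x y. B y x"] diag by metis
qed

section \<open>Transformations\<close>

(* On two or three points class_D is vacuous and the conclusion fails: take Q = 0 and K nonzero at a
   single off-diagonal position. An infinite L has card L = 0 and is therefore not excluded. *)
theorem theorem1p1:
  fixes L :: "'a set"
    and K Q :: "'a \<Rightarrow> 'a \<Rightarrow> 'f::field"
  assumes "card L \<noteq> 2" and "card L \<noteq> 3"
    and "class_D L K" and "class_D L Q"
    and "determinantally_equivalent L K Q"
  shows "transformable L Q K"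
proof (cases "\<forall>x y v. \<exists>w\<in>L. w \<notin> {x, y, v}")
  case True
  have "determinantally_equivalent L Q K"
    using assms(5) by (simp add: determinantally_equivalent_def)
  from conjugation_up_to_transposition_if_class_D[OF this assms(4)] True
  consider "conjugation_transformation L Q K" | "conjugation_transformation L Q (\<lambda>x y. K y x)"
    by blast
  then show ?thesis
  proof cases
    case 1
    then show ?thesis by (auto simp: transformation_step_def)
  next
    case 2
    have "transformation_step L (\<lambda>x y. K y x) K"
      by (simp add: transformation_step_def transposition_transformation_def)
    moreover have "transformation_step L Q (\<lambda>x y. K y x)"
      using 2 by (simp add: transformation_step_def)
    ultimately show ?thesis by (meson converse_rtranclp_into_rtranclp r_into_rtranclp)
  qed
next
  case False
  then obtain x y v where sub: "L \<subseteq> {x, y, v}" by blast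
  then have "finite L" by (rule finite_subset) simp
  have "card L \<le> card {x, y, v}" using sub by (intro card_mono) auto
  also have "\<dots> \<le> 3" by (simp add: card_insert_if)
  finally have "card L \<le> 3" .
  then have "card L \<le> 1" using assms(1,2) by linarith
  then have single: "a = b" if "a \<in> L" "b \<in> L" for a b
    using \<open>finite L\<close> that card_le_Suc0_iff_eq[of L] by simp
  have "K a b = Q a b" if "a \<in> L" "b \<in> L" for a b
    using single[OF that] principal_minors_2(1)[OF assms(5) that(1) that(1)] by simp
  then have "conjugation_transformation L Q K"
    unfolding conjugation_transformation_def by (intro exI[of _ "\<lambda>_. 1"]) auto
  then show ?thesis by (auto simp: transformation_step_def)
qed

end
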